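(* Let $\lambda>0$, let $p=Po(\lambda)$ be the mean-$\lambda$ Poisson density, and let $q$ be a density with support $[0,\ldots,N]$, $N\in\mathbb{N}\cup\{\infty\}$ (with support $\mathbb{N}$ if $N=\infty$). Set $$H(\lambda):=1\wedge\sqrt{\frac{2}{e\lambda}}.$$ Then $$\|p-q\|_{TV}\le\sqrt{\lambda}\,H(\lambda)\sqrt{\mathcal{K}_1(Po(\lambda),q)}+e^N_q,$$ where the error term $e^N_q$ is of order $q(N)/(N+1)$, i.e. $|e^N_q|\le C\,q(N)/(N+1)$ for a constant $C$ depending only on $\lambda$ (and $e^N_q=0$ if $N=\infty$). Moreover, if $N=\infty$, then $$\|p-q\|_{TV}\le H(\lambda)\sqrt{\mathcal{K}_2(Po(\lambda),q)}.$$
   Context: A "density" means a discrete probability mass function; its support is the set where it is positive. $\mathbb{N}=\{0,1,2,\ldots\}$. The Poisson density is $p(x)=e^{-\lambda}\lambda^x/x!$ for $x\in\mathbb{N}$. The total variation distance is $\|p-q\|_{TV}:=\frac12\sum_x|p(x)-q(x)|$. For a density $q$ with support $S_q$, $\mathrm{E}_q[l(X)]:=\sum_{k\in S_q}l(k)q(k)$. The scaled Fisher information is $$\mathcal{K}_1(Po(\lambda),q):=\lambda\,\mathrm{E}_q\left[\left(\frac{(X+1)q(X+1)}{\lambda q(X)}-1\right)^2\right],$$ and the discrete Fisher information is $$\mathcal{K}_2(Po(\lambda),q):=\mathrm{E}_q\left[\left(\frac{\lambda q(X-1)}{q(X)}-X\right)^2\right],$$ with $q(x)=0$ for $x$ outside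 the support (in particular $q(-1)=0$). $u\wedge v$ denotes $\min(u,v)$. *)

theory Defs
  imports "HOL-Probability.Probability"
begin

text \<open>
  Densities supported on natural numbers are rendered as \<open>nat pmf\<close>; the support is \<open>set_pmf\<close>,
  and \<open>poisson_pmf rate\<close> is the Poisson density for \<open>rate > 0\<close>.
\<close>

definition total_variation :: "'a pmf \<Rightarrow> 'a pmf \<Rightarrow> real" where
  "total_variation p q = 1 / 2 * (\<Sum>\<^sub>\<infinity>x. \<bar>pmf p x - pmf q x\<bar>)"

text \<open>
  The mean of a nonnegative \<open>l\<close>, which may be infinite. As \<open>measure_pmf q\<close> is concentrated on
  \<open>set_pmf q\<close>, this is the sum of \<open>l k * pmf q k\<close> over the support; the values of \<open>l\<close> elsewhere
  are irrelevant. A negative value of \<open>l\<close> would be truncated to 0; below, \<open>l\<close> is always a square.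
\<close>
definition pmf_mean :: "nat pmf \<Rightarrow> (nat \<Rightarrow> real) \<Rightarrow> ereal" where
  "pmf_mean q l = enn2ereal (\<integral>\<^sup>+ k. ennreal (l k) \<partial>measure_pmf q)"

definition scaled_fisher_information :: "real \<Rightarrow> nat pmf \<Rightarrow> ereal" where
  "scaled_fisher_information rate q =
     ereal rate * pmf_mean q (\<lambda>x. (real (x + 1) * pmf q (x + 1) / (rate * pmf q x) - 1)\<^sup>2)"

text \<open>The case distinction implements \<open>q(-1) = 0\<close>; subtraction on \<open>nat\<close> would give \<open>q(0)\<close>.\<close>
definition discrete_fisher_information :: "real \<Rightarrow> nat pmf \<Rightarrow> ereal" where
  "discrete_fisher_information rate q =
     pmf_mean q (\<lambda>x. (rate * (if x = 0 then 0 else pmf q (x - 1)) / pmf q x - real x)\<^sup>2)"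

text \<open>The square root on the nonnegative extended reals.\<close>
definition ereal_sqrt :: "ereal \<Rightarrow> ereal" where
  "ereal_sqrt x = (if x = \<infinity> then \<infinity> else ereal (sqrt (real_of_ereal x)))"

definition stein_factor :: "real \<Rightarrow> real" where
  "stein_factor rate = min 1 (sqrt (2 / (exp 1 * rate)))"

end

theory Submission
  imports Defs
begin

text \<open>
  The proof is Stein's method for the Poisson law. Let \<open>f\<close> be the indicator of \<open>{p > q}\<close>, so that
  the total variation distance is the difference of the means of \<open>f\<close> under \<open>p\<close> and under \<open>q\<close>. If
  \<open>g\<close> solves the Stein equation \<open>rate * g (k + 1) - k * g k = f k - E\<^sub>p f\<close>, then averaging over
  \<open>q\<close> and shifting the index in one of the two sums gives
  \<open>total_variation p q = (\<Sum>k. g (k + 1) * ((k + 1) * q (k + 1) - rate * q k))\<close>.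
  Hence the distance is at most \<open>sup \<bar>g\<bar>\<close> times the sum of the
  \<open>\<bar>(k + 1) * q (k + 1) - rate * q k\<bar>\<close>. Dividing the summand by \<open>q k\<close> or by \<open>q (k + 1)\<close> turns
  this sum into a first absolute moment under \<open>q\<close>, and Cauchy-Schwarz bounds it by the root of the
  scaled or of the discrete Fisher information. If the support ends at \<open>N\<close>, the term of index \<open>N\<close>
  is the one where \<open>q (N + 1) = 0\<close>, which the scaled Fisher information counts as well; the
  summation by parts therefore leaves no boundary term, and the error \<open>0\<close> can be chosen.

  What remains is \<open>\<bar>g\<bar> \<le> stein_factor rate\<close>. Let \<open>W\<close> be the sum of independent variables with
  laws \<open>Bin (k, 1 - u)\<close> and \<open>Po (rate * u)\<close>; as \<open>u\<close> goes from 0 to 1 it moves from the point \<open>k\<close>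
  to the Poisson law. This is the immigration-death process at time \<open>- ln (1 - u)\<close>, and its
  backward equation, integrated over \<open>u\<close>, says that minus the integral over \<open>[0, 1]\<close> of
  \<open>E f (W + 1) - E f W\<close> is the solution at \<open>k + 1\<close> (\<open>thinned_mean_derivative\<close>,
  \<open>stein_equation\<close>). The integrand is at most 1 in absolute value. Conditioning on the binomial
  part, it is also at most the corresponding quantity for \<open>Po (rate * u)\<close> alone, which by
  unimodality is at most the largest Poisson weight, and that is at most
  \<open>1 / sqrt (2 * e * rate * u)\<close> (\<open>poisson_weight_le\<close>). Integrating the two bounds gives the two
  terms of the minimum in \<open>stein_factor\<close>.
\<close>

section \<open>The largest weight of a Poisson law\<close>

lemma add_log_minus_sub_log_le:
  fixes t :: real
  assumes "0 \<le> t" "t < 1"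
  shows "(1 + t) * ln (1 + t) - (1 - t) * ln (1 - t) \<le> 2 * t"
proof -
  define F where "F s = 2 * s - ((1 + s) * ln (1 + s) - (1 - s) * ln (1 - s))" for s :: real
  have "F 0 \<le> F t"
  proof (rule DERIV_nonneg_imp_nondecreasing[where f = F])
    show "0 \<le> t" by fact
    fix s assume s: "0 \<le> s" "s \<le> t"
    have "(F has_real_derivative - (ln (1 + s) + ln (1 - s))) (at s)"
      unfolding F_def using s assms by (auto intro!: derivative_eq_intros)
    moreover have "1 - s\<^sup>2 = (1 + s) * (1 - s)" by (simp add: algebra_simps power2_eq_square)
    then have "ln (1 - s\<^sup>2) = ln (1 + s) + ln (1 - s)"
      using s assms by (simp add: ln_mult)
    moreover have "s\<^sup>2 < 1"
      using s assms by (simp add: power_less_one_iff abs_square_less_1)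
    then have "ln (1 - s\<^sup>2) \<le> 0" by (subst ln_le_zero_iff) auto
    ultimately show "\<exists>y. (F has_real_derivative y) (at s) \<and> 0 \<le> y" by auto
  qed
  then show ?thesis by (simp add: F_def)
qed

text \<open>
  This is the midpoint inequality for the concave function \<open>ln x + 1\<close>, whose antiderivative is
  \<open>x * ln x\<close>, on the unit interval around \<open>k + 1\<close>. Rescaling by \<open>k + 1\<close> reduces it to the
  preceding lemma.
\<close>
lemma half_shift_log_step:
  "(real k + 3 / 2) * ln (real k + 3 / 2) - (real k + 1 / 2) * ln (real k + 1 / 2)
     \<le> 1 + ln (real k + 1)"
proof -
  define m where "m = real k + 1"
  define t where "t = 1 / (2 * m)"
  have m: "m \<ge> 1" by (simp add: m_def)
  have t: "0 \<le> t" "t < 1" using m by (auto simp: t_def)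
  have mt: "m * t = 1 / 2" using m by (simp add: t_def)
  have a: "real k + 3 / 2 = m * (1 + t)" "real k + 1 / 2 = m * (1 - t)"
    using mt by (auto simp: m_def algebra_simps)
  have l1: "ln (m * (1 + t)) = ln m + ln (1 + t)"
    using m t by (subst ln_mult) auto
  have l2: "ln (m * (1 - t)) = ln m + ln (1 - t)"
    using m t by (subst ln_mult) auto
  have "(real k + 3 / 2) * ln (real k + 3 / 2) - (real k + 1 / 2) * ln (real k + 1 / 2)
      = 2 * (m * t) * ln m + m * ((1 + t) * ln (1 + t) - (1 - t) * ln (1 - t))"
    unfolding a l1 l2 by (simp add: algebra_simps)
  also have "\<dots> \<le> 2 * (m * t) * ln m + m * (2 * t)"
    using add_log_minus_sub_log_le[OF t] m by (intro add_left_mono mult_left_mono) auto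
  also have "\<dots> = ln m + 2 * (m * t)" using mt by simp
  also have "\<dots> = 1 + ln m" using mt by simp
  finally show ?thesis by (simp add: m_def)
qed

definition poisson_weight :: "real \<Rightarrow> nat \<Rightarrow> real" where
  "poisson_weight x i = exp (- x) * x ^ i / fact i"

text \<open>
  For fixed \<open>k\<close>, the product of \<open>sqrt x\<close> and the weight is largest at \<open>x = k + 1 / 2\<close>. The
  logarithm of this maximum decreases in \<open>k\<close>, and its value for \<open>k = 0\<close> is the logarithm of
  \<open>1 / sqrt (2 * e)\<close>.
\<close>
lemma poisson_weight_le:
  assumes x: "x > 0"
  shows "poisson_weight x k \<le> 1 / sqrt (2 * exp 1 * x)"
proof -
  \<comment> \<open>the logarithm of the maximum over \<open>x\<close>\<close>
  define L where "L k = (real k + 1 / 2) * ln (real k + 1 / 2) - (real k + 1 / 2) - ln (fact k)"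
    for k :: nat
  have "L k \<le> L 0"
  proof (induction k)
    case (Suc k)
    have "ln (fact (Suc k) :: real) = ln (real k + 1) + ln (fact k)"
      by (simp add: ln_mult add.commute)
    moreover have "real (Suc k) + 1 / 2 = real k + 3 / 2" by simp
    then have "L (Suc k) = (real k + 3 / 2) * ln (real k + 3 / 2) - (real k + 3 / 2) - ln (fact (Suc k))"
      unfolding L_def by (simp only:)
    ultimately have "L (Suc k) \<le> L k"
      using half_shift_log_step[of k] unfolding L_def by linarith
    with Suc show ?case by simp
  qed simp
  moreover have "(real k + 1 / 2) * ln x - x \<le> (real k + 1 / 2) * ln (real k + 1 / 2) - (real k + 1 / 2)"
  proof -
    define a where "a = real k + 1 / 2"
    have a: "a > 0" by (simp add: a_def)
    have "ln (x / a) \<le> x / a - 1" using x a by (intro ln_le_minus_one) auto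
    then have "a * ln (x / a) \<le> a * (x / a - 1)" using a by (intro mult_left_mono) auto
    then have "a * ln x - x \<le> a * ln a - a" using x a by (simp add: ln_div algebra_simps)
    then show ?thesis by (simp add: a_def)
  qed
  ultimately have le: "(real k + 1 / 2) * ln x - x - ln (fact k) \<le> - ln 2 / 2 - 1 / 2"
    by (simp add: L_def ln_div)
  have "ln (poisson_weight x k) = - x + real k * ln x - ln (fact k)"
    using x by (simp add: poisson_weight_def ln_mult ln_div ln_realpow)
  also have "\<dots> \<le> - (ln 2 + 1 + ln x) / 2"
    using le by (simp add: field_simps)
  also have "\<dots> = ln (1 / sqrt (2 * exp 1 * x))"
    using x by (simp add: ln_div ln_sqrt ln_mult add_divide_distrib)
  finally show ?thesis
    using x by (subst (asm) ln_le_cancel_iff) (auto simp: poisson_weight_def)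
qed

section \<open>Mean increments under a unimodal weight\<close>

text \<open>
  Summation by parts turns the sum into one of \<open>f i * (p (i - 1) - p i)\<close>, whose terms are at most
  0 up to the mode \<open>m\<close> and at least 0 beyond it. As \<open>f\<close> has values in the unit interval, either
  group contributes at most the telescoping sum of the differences, hence at most \<open>p m\<close>. The two
  invariants below carry this out for the partial sums on either side of the mode.
\<close>
lemma unimodal_weighted_increments_le:
  fixes p f :: "nat \<Rightarrow> real"
  assumes p: "\<And>i. p i \<ge> 0"
    and up: "\<And>i. i < m \<Longrightarrow> p i \<le> p (Suc i)"
    and down: "\<And>i. m \<le> i \<Longrightarrow> p (Suc i) \<le> p i"
    and f: "\<And>i. 0 \<le> f i" "\<And>i. f i \<le> 1"
    and S: "(\<lambda>i. p i * (f (Suc i) - f i)) sums S"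
  shows "\<bar>S\<bar> \<le> p m"
proof -
  define T where "T n = (\<Sum>i<n. p i * (f (Suc i) - f i))" for n
  have inc: "p n * (f n - 1) \<le> T n \<and> T n \<le> p n * f n" if "n \<le> m" for n
    using that
  proof (induction n)
    case 0
    show ?case using p[of 0] f[of 0] by (simp add: T_def mult_nonneg_nonpos)
  next
    case (Suc n)
    have "p n * f (Suc n) \<le> p (Suc n) * f (Suc n)"
      using Suc.prems up[of n] f by (intro mult_right_mono) auto
    moreover have "p (Suc n) * (f (Suc n) - 1) \<le> p n * (f (Suc n) - 1)"
      using Suc.prems up[of n] f by (intro mult_right_mono_neg) auto
    ultimately show ?case using Suc by (simp add: T_def algebra_simps)
  qed
  have dec: "p n * f n - p m \<le> T n \<and> T n \<le> p n * (f n - 1) + p m" if "m \<le> n" for n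
    using that
  proof (induction n rule: dec_induct)
    case base
    show ?case using inc[of m] by (simp add: algebra_simps)
  next
    case (step n)
    have "p (Suc n) * f (Suc n) \<le> p n * f (Suc n)"
      using step down[of n] f by (intro mult_right_mono) auto
    moreover have "p n * (f (Suc n) - 1) \<le> p (Suc n) * (f (Suc n) - 1)"
      using step down[of n] f by (intro mult_right_mono_neg) auto
    ultimately show ?case using step by (simp add: T_def algebra_simps)
  qed
  have "\<bar>T n\<bar> \<le> p m" if "m \<le> n" for n
  proof -
    have "0 \<le> p n * f n" "p n * (f n - 1) \<le> 0"
      using p[of n] f[of n] by (auto simp: mult_nonneg_nonpos)
    with dec[OF that] show ?thesis by linarith
  qed
  moreover have "T \<longlonglongrightarrow> S" using S by (simp add: sums_def T_def[abs_def])
  ultimately show ?thesis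
    by (intro LIMSEQ_le_const2[OF tendsto_rabs]) auto
qed

lemma poisson_weight_Suc: "poisson_weight x (Suc i) = poisson_weight x i * (x / (real i + 1))"
  by (simp add: poisson_weight_def field_simps)

lemma poisson_weighted_increments_le:
  fixes f :: "nat \<Rightarrow> real"
  assumes x: "x > 0" and f: "\<And>i. 0 \<le> f i" "\<And>i. f i \<le> 1"
    and S: "(\<lambda>i. poisson_weight x i * (f (Suc i) - f i)) sums S"
  shows "\<bar>S\<bar> \<le> 1 / sqrt (2 * exp 1 * x)"
proof -
  have pos: "poisson_weight x i \<ge> 0" for i using x by (simp add: poisson_weight_def)
  have "\<bar>S\<bar> \<le> poisson_weight x (nat \<lfloor>x\<rfloor>)"
  proof (rule unimodal_weighted_increments_le[OF pos _ _ f S])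
    fix i assume "i < nat \<lfloor>x\<rfloor>"
    then have "real i + 1 \<le> x" by linarith
    then have "1 \<le> x / (real i + 1)" by simp
    from mult_left_mono[OF this pos[of i]]
    show "poisson_weight x i \<le> poisson_weight x (Suc i)" by (simp add: poisson_weight_Suc)
  next
    fix i assume "nat \<lfloor>x\<rfloor> \<le> i"
    then have "x \<le> real i + 1" by linarith
    then have "x / (real i + 1) \<le> 1" by simp
    from mult_left_mono[OF this pos[of i]]
    show "poisson_weight x (Suc i) \<le> poisson_weight x i" by (simp add: poisson_weight_Suc)
  qed
  also note poisson_weight_le[OF x]
  finally show ?thesis .
qed

section \<open>Thinned Poisson means\<close>

text \<open>The mean of \<open>f (j + Y)\<close> for \<open>Y\<close> with law \<open>Po x\<close>; the power series form is there to be
  differentiated in \<open>x\<close>.\<close>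
definition poisson_mean :: "(nat \<Rightarrow> real) \<Rightarrow> nat \<Rightarrow> real \<Rightarrow> real" where
  "poisson_mean f j x = exp (- x) * (\<Sum>i. f (i + j) / fact i * x ^ i)"

text \<open>
  The mean of \<open>f (j + B + Y)\<close> for independent \<open>B\<close> with law \<open>Bin (k, 1 - u)\<close> and \<open>Y\<close> with law
  \<open>Po (rate * u)\<close>. The recursion conditions on one of the \<open>k\<close> Bernoulli variables that make up
  \<open>B\<close>, so that all properties follow from the Poisson case by induction. The offset \<open>j\<close> is what
  the recursion shifts.
\<close>
primrec thinned_mean :: "(nat \<Rightarrow> real) \<Rightarrow> real \<Rightarrow> nat \<Rightarrow> nat \<Rightarrow> real \<Rightarrow> real" where
  "thinned_mean f rate 0 j u = poisson_mean f j (rate * u)"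
| "thinned_mean f rate (Suc k) j u =
     (1 - u) * thinned_mean f rate k (Suc j) u + u * thinned_mean f rate k j u"

definition thinned_increment :: "(nat \<Rightarrow> real) \<Rightarrow> real \<Rightarrow> nat \<Rightarrow> nat \<Rightarrow> real \<Rightarrow> real" where
  "thinned_increment f rate k j u =
     thinned_mean f rate k (Suc j) u - thinned_mean f rate k j u"

lemma thinned_increment_Suc:
  "thinned_increment f rate (Suc k) j u =
     (1 - u) * thinned_increment f rate k (Suc j) u + u * thinned_increment f rate k j u"
  by (simp add: thinned_increment_def algebra_simps)

lemma thinned_mean_at_0: "thinned_mean f rate k j 0 = f (j + k)"
proof (induction k arbitrary: j)
  case 0
  have "(\<Sum>i. f (i + j) / fact i * 0 ^ i) = f j"
    using powser_zero[of "\<lambda>i. f (i + j) / fact i"] by simp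
  then show ?case by (simp add: poisson_mean_def)
qed simp

lemma thinned_mean_at_1: "thinned_mean f rate k j 1 = poisson_mean f j rate"
  by (induction k arbitrary: j) auto

context
  fixes f :: "nat \<Rightarrow> real"
  assumes f_nonneg: "\<And>i. 0 \<le> f i" and f_le_1: "\<And>i. f i \<le> 1"
begin

lemma poisson_mean_summable: "summable (\<lambda>i. f (i + j) / fact i * (x :: real) ^ i)"
proof (rule summable_comparison_test'[where N = 0])
  show "summable (\<lambda>i. inverse (fact i) * \<bar>x\<bar> ^ i)" by (rule summable_exp)
  show "norm (f (i + j) / fact i * x ^ i) \<le> inverse (fact i) * \<bar>x\<bar> ^ i" for i
    using f_nonneg[of "i + j"] mult_right_mono[OF f_le_1[of "i + j"], of "\<bar>x\<bar> ^ i"]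
    by (simp add: abs_mult power_abs field_simps)
qed

lemma poisson_mean_sums: "(\<lambda>i. poisson_weight x i * f (i + j)) sums poisson_mean f j x"
  using sums_mult[OF summable_sums[OF poisson_mean_summable[of j x]], of "exp (- x)"]
  by (simp add: poisson_mean_def poisson_weight_def field_simps)

lemma poisson_mean_bounds:
  assumes "x \<ge> 0"
  shows "0 \<le> poisson_mean f j x" "poisson_mean f j x \<le> 1"
proof -
  have pos: "poisson_weight x i \<ge> 0" for i using assms by (simp add: poisson_weight_def)
  show "0 \<le> poisson_mean f j x"
    by (rule sums_le[OF _ sums_zero poisson_mean_sums]) (simp add: pos f_nonneg)
  have "(\<lambda>i. exp (- x) * (inverse (fact i) * x ^ i)) sums (exp (- x) * exp x)"
    using exp_converges[of x] by (intro sums_mult) (simp add: scaleR_conv_of_real)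
  then have "poisson_weight x sums 1"
    by (simp add: poisson_weight_def[abs_def] exp_minus field_simps)
  then show "poisson_mean f j x \<le> 1"
    using pos f_le_1 by (intro sums_le[OF _ poisson_mean_sums[of x j]]) (auto intro: mult_left_le)
qed

lemma poisson_mean_derivative:
  "(poisson_mean f j has_real_derivative poisson_mean f (Suc j) x - poisson_mean f j x) (at x)"
proof -
  define c where "c i = f (i + j) / fact i" for i
  have "diffs c i = f (i + Suc j) / fact i" for i
    by (simp add: c_def diffs_def field_simps del: of_nat_Suc)
  then have d: "diffs c = (\<lambda>i. f (i + Suc j) / fact i)" by auto
  have "summable (\<lambda>i. c i * y ^ i)" for y :: real
    unfolding c_def by (rule poisson_mean_summable)
  then have "((\<lambda>x. \<Sum>i. c i * x ^ i) has_real_derivative (\<Sum>i. diffs c i * x ^ i)) (at x)"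
    by (rule termdiffs_strong_converges_everywhere)
  then show ?thesis
    unfolding poisson_mean_def[abs_def] d unfolding c_def
    by (auto intro!: derivative_eq_intros simp: algebra_simps)
qed

text \<open>
  The backward equation of the immigration-death process, with time \<open>- ln (1 - u)\<close>: immigration
  at rate \<open>rate\<close> adds an individual, and each of the \<open>k\<close> initial ones dies at rate 1. The
  truncated \<open>k - 1\<close> at \<open>k = 0\<close> is harmless because of the factor \<open>k\<close>.
\<close>
lemma thinned_mean_derivative:
  "(thinned_mean f rate k j has_real_derivative
      rate * thinned_increment f rate k j u - real k * thinned_increment f rate (k - 1) j u) (at u)"
proof (induction k arbitrary: j)
  case 0
  have "((\<lambda>u. poisson_mean f j (rate * u)) has_real_derivative
          (poisson_mean f (Suc j) (rate * u) - poisson_mean f j (rate * u)) * rate) (at u)"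
    by (rule DERIV_chain2[OF poisson_mean_derivative])
       (auto intro!: derivative_eq_intros)
  then show ?case by (simp add: thinned_increment_def mult.commute)
next
  case (Suc k)
  have *: "real k * thinned_increment f rate k j u =
     real k * ((1 - u) * thinned_increment f rate (k - 1) (Suc j) u +
       u * thinned_increment f rate (k - 1) j u)"
    by (cases k) (simp_all add: thinned_increment_Suc)
  note Suc[derivative_intros]
  have "((\<lambda>u. (1 - u) * thinned_mean f rate k (Suc j) u + u * thinned_mean f rate k j u)
      has_real_derivative
        - thinned_increment f rate k j u
        + (1 - u) * (rate * thinned_increment f rate k (Suc j) u -
            real k * thinned_increment f rate (k - 1) (Suc j) u)
        + u * (rate * thinned_increment f rate k j u -
            real k * thinned_increment f rate (k - 1) j u)) (at u)"
    by (auto intro!: derivative_eq_intros simp: thinned_increment_def algebra_simps)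
  also have "- thinned_increment f rate k j u
        + (1 - u) * (rate * thinned_increment f rate k (Suc j) u -
            real k * thinned_increment f rate (k - 1) (Suc j) u)
        + u * (rate * thinned_increment f rate k j u -
            real k * thinned_increment f rate (k - 1) j u)
      = rate * thinned_increment f rate (Suc k) j u - thinned_increment f rate k j u
        - real k * thinned_increment f rate k j u"
    unfolding * thinned_increment_Suc by (simp add: algebra_simps)
  finally show ?case by (simp add: algebra_simps)
qed

text \<open>
  Adding an independent binomial variable averages the increment over shifts, which cannot enlarge
  a bound that holds for all shifts.
\<close>
lemma thinned_increment_bound:
  assumes u: "0 \<le> u" "u \<le> 1" and base: "\<And>j. \<bar>thinned_increment f rate 0 j u\<bar> \<le> M"
  shows "\<bar>thinned_increment f rate k j u\<bar> \<le> M"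
proof (induction k arbitrary: j)
  case (Suc k)
  have "\<bar>thinned_increment f rate (Suc k) j u\<bar>
      \<le> (1 - u) * \<bar>thinned_increment f rate k (Suc j) u\<bar> + u * \<bar>thinned_increment f rate k j u\<bar>"
    unfolding thinned_increment_Suc using u by (simp add: abs_mult abs_triangle_ineq[THEN order_trans])
  also have "\<dots> \<le> (1 - u) * M + u * M"
    using Suc u by (intro add_mono mult_left_mono) auto
  finally show ?case by (simp add: algebra_simps)
qed (rule base)

lemma thinned_increment_le_1:
  assumes "0 \<le> u" "u \<le> 1" "rate > 0"
  shows "\<bar>thinned_increment f rate k j u\<bar> \<le> 1"
proof (rule thinned_increment_bound[OF assms(1,2)])
  fix j
  have "0 \<le> rate * u" using assms by simp
  from poisson_mean_bounds[OF this, of j] poisson_mean_bounds[OF this, of "Suc j"]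
  show "\<bar>thinned_increment f rate 0 j u\<bar> \<le> 1"
    by (simp add: thinned_increment_def)
qed

lemma thinned_increment_le_inverse_sqrt:
  assumes "0 < u" "u \<le> 1" "rate > 0"
  shows "\<bar>thinned_increment f rate k j u\<bar> \<le> 1 / sqrt (2 * exp 1 * (rate * u))"
proof (rule thinned_increment_bound)
  fix j
  have "(\<lambda>i. poisson_weight (rate * u) i * (f (Suc i + j) - f (i + j))) sums
          thinned_increment f rate 0 j u"
    using sums_diff[OF poisson_mean_sums[of "rate * u" "Suc j"] poisson_mean_sums[of "rate * u" j]]
    by (simp add: thinned_increment_def algebra_simps)
  then show "\<bar>thinned_increment f rate 0 j u\<bar> \<le> 1 / sqrt (2 * exp 1 * (rate * u))"
    using assms f_nonneg f_le_1
    by (intro poisson_weighted_increments_le[where f = "\<lambda>i. f (i + j)"]) auto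
qed (use assms in auto)

section \<open>The Stein equation and its solution\<close>

lemma thinned_increment_integrable: "thinned_increment f rate k j integrable_on {0..1}"
proof -
  have "continuous_on {0..1} (thinned_mean f rate k j)" for j
    using DERIV_isCont[OF thinned_mean_derivative] by (simp add: continuous_at_imp_continuous_on)
  then show ?thesis
    unfolding thinned_increment_def[abs_def]
    by (intro integrable_continuous_real continuous_intros)
qed

text \<open>
  The value for \<open>k > 0\<close> is the one that the integrated backward equation dictates. The Stein
  equation leaves the value at 0 open; here it equals the value at 1.
\<close>
definition stein_solution :: "real \<Rightarrow> nat \<Rightarrow> real" where
  "stein_solution rate k = - integral {0..1} (thinned_increment f rate (k - 1) 0)"

text \<open>
  Integrate the backward equation from \<open>u = 0\<close>, where the thinned mean is \<open>f k\<close>, to \<open>u = 1\<close>,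
  where it is the mean of \<open>f\<close> under the Poisson law.
\<close>
lemma stein_equation:
  "rate * stein_solution rate (Suc k) - real k * stein_solution rate k = f k - poisson_mean f 0 rate"
proof -
  have "((\<lambda>u. rate * thinned_increment f rate k 0 u - real k * thinned_increment f rate (k - 1) 0 u)
          has_integral thinned_mean f rate k 0 1 - thinned_mean f rate k 0 0) {0..1}"
    by (rule fundamental_theorem_of_calculus)
       (use has_field_derivative_at_within[OF thinned_mean_derivative] in
          \<open>auto simp flip: has_real_derivative_iff_has_vector_derivative\<close>)
  moreover have "((\<lambda>u. rate * thinned_increment f rate k 0 u - real k * thinned_increment f rate (k - 1) 0 u)
          has_integral rate * integral {0..1} (thinned_increment f rate k 0)
            - real k * integral {0..1} (thinned_increment f rate (k - 1) 0)) {0..1}"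
    by (intro has_integral_diff has_integral_mult_right integrable_integral
          thinned_increment_integrable)
  ultimately show ?thesis
    by (auto dest: has_integral_unique simp: stein_solution_def thinned_mean_at_0 thinned_mean_at_1)
qed

text \<open>
  The bounds 1 and \<open>1 / sqrt (2 * e * rate * u)\<close> on the increments are integrated over \<open>u\<close>; the
  integral of \<open>1 / sqrt u\<close> is 2.
\<close>
lemma stein_solution_bound:
  assumes rate: "rate > 0"
  shows "\<bar>stein_solution rate k\<bar> \<le> stein_factor rate"
proof -
  let ?D = "thinned_increment f rate (k - 1) 0"
  have "norm (integral {0..1} ?D) \<le> integral {0..1} (\<lambda>u::real. 1 :: real)"
    using thinned_increment_le_1[OF _ _ rate]
    by (intro integral_norm_bound_integral thinned_increment_integrable) auto
  then have 1: "\<bar>stein_solution rate k\<bar> \<le> 1" by (simp add: stein_solution_def)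
  define c where "c = 1 / sqrt (2 * exp 1 * rate)"
  have "((\<lambda>u. c / sqrt u) has_integral 2 * c * sqrt 1 - 2 * c * sqrt 0) {0..1}"
  proof (rule fundamental_theorem_of_calculus_interior)
    show "continuous_on {0..1} (\<lambda>u. 2 * c * sqrt u)" by (intro continuous_intros)
    fix u :: real assume "u \<in> {0<..<1}"
    then show "((\<lambda>u. 2 * c * sqrt u) has_vector_derivative c / sqrt u) (at u)"
      by (auto intro!: derivative_eq_intros simp: field_simps
            simp flip: has_real_derivative_iff_has_vector_derivative)
  qed simp
  then have int: "((\<lambda>u. c / sqrt u) has_integral 2 * c) {0..1}" by simp
  \<comment> \<open>At \<open>u = 0\<close> the bound \<open>c / sqrt u\<close> is 0, so the integrand is set to 0 there.\<close>
  have "((\<lambda>u. if u = 0 then 0 else ?D u) has_integral integral {0..1} ?D) {0..1}"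
    by (rule has_integral_spike[OF _ _ integrable_integral[OF thinned_increment_integrable],
          where S = "{0}"]) auto
  moreover have "norm (if u = 0 then 0 else ?D u) \<le> c / sqrt u" if "u \<in> {0..1}" for u
    using that thinned_increment_le_inverse_sqrt[OF _ _ rate, of u]
    by (auto simp: c_def real_sqrt_mult mult.assoc)
  ultimately have "norm (integral {0..1} ?D) \<le> 2 * c"
    using integral_norm_bound_integral[of "\<lambda>u. if u = 0 then 0 else ?D u" "{0..1}" "\<lambda>u. c / sqrt u"] int
    by (auto simp: has_integral_iff)
  moreover have "2 / (exp 1 * rate) = 4 / (2 * exp 1 * rate)" by (simp add: field_simps)
  then have "2 * c = sqrt (2 / (exp 1 * rate))"
    by (simp only: c_def real_sqrt_divide real_sqrt_four)
  ultimately show ?thesis using 1 by (simp add: stein_solution_def stein_factor_def)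
qed

end

section \<open>From the Stein equation to the total variation distance\<close>

lemma pmf_sums_1: "pmf (r :: nat pmf) sums 1"
proof -
  have "(\<integral>k. pmf r k \<partial>count_space UNIV) = 1" by (simp add: integral_pmf)
  then show ?thesis using sums_integral_count_space_nat[OF integrable_pmf, of r] by simp
qed

text \<open>
  As both densities have total mass 1, the positive and the negative part of their difference have
  the same sum, and half the sum of the absolute values is the sum of the positive part.
\<close>
lemma total_variation_eq_sums:
  fixes p q :: "nat pmf"
  shows "(\<lambda>k. (pmf p k - pmf q k) * (if pmf p k > pmf q k then 1 else 0)) sums total_variation p q"
proof -
  have sm: "summable (\<lambda>k. \<bar>pmf p k - pmf q k\<bar>)"
    by (rule summable_comparison_test'[where N = 0,
          OF summable_add[OF sums_summable[OF pmf_sums_1[of p]] sums_summable[OF pmf_sums_1[of q]]]])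
       (auto simp: abs_if)
  then have "(\<lambda>k. \<bar>pmf p k - pmf q k\<bar>) summable_on UNIV"
    by (intro norm_summable_imp_summable_on) simp
  then have "infsum (\<lambda>k. \<bar>pmf p k - pmf q k\<bar>) UNIV = suminf (\<lambda>k. \<bar>pmf p k - pmf q k\<bar>)"
    by (intro sums_unique has_sum_imp_sums has_sum_infsum)
  then have "(\<lambda>k. 1 / 2 * (\<bar>pmf p k - pmf q k\<bar> + (pmf p k - pmf q k))) sums
      (1 / 2 * ((\<Sum>\<^sub>\<infinity>k. \<bar>pmf p k - pmf q k\<bar>) + (1 - 1)))"
    using summable_sums[OF sm] by (intro sums_mult sums_add sums_diff pmf_sums_1) simp
  also have "(\<lambda>k. 1 / 2 * (\<bar>pmf p k - pmf q k\<bar> + (pmf p k - pmf q k))) =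
      (\<lambda>k. (pmf p k - pmf q k) * (if pmf p k > pmf q k then 1 else 0))"
    by (auto simp: fun_eq_iff)
  finally show ?thesis by (simp add: total_variation_def)
qed

text \<open>
  Averaging the Stein equation over \<open>q\<close> expresses the distance as the sum of the terms
  \<open>g (k + 1) * ((k + 1) * q (k + 1) - rate * q k)\<close>, as explained at the top.
\<close>
lemma total_variation_poisson_le:
  fixes q :: "nat pmf"
  assumes rate: "rate > 0"
    and S: "(\<lambda>k. \<bar>real (Suc k) * pmf q (Suc k) - rate * pmf q k\<bar>) sums S"
  shows "total_variation (poisson_pmf rate) q \<le> stein_factor rate * S"
proof -
  let ?p = "poisson_pmf rate" and ?H = "stein_factor rate"
  define f :: "nat \<Rightarrow> real" where "f k = (if pmf ?p k > pmf q k then 1 else 0)" for k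
  have f: "0 \<le> f i" "f i \<le> 1" for i by (auto simp: f_def)
  define g where "g = stein_solution f rate"
  have g: "\<bar>g k\<bar> \<le> ?H" for k unfolding g_def by (rule stein_solution_bound[OF f rate])
  have stein: "rate * g (Suc k) - real k * g k = f k - poisson_mean f 0 rate" for k
    unfolding g_def by (rule stein_equation[OF f])
  have "(\<lambda>k. pmf ?p k * f k) sums poisson_mean f 0 rate"
    using poisson_mean_sums[of f rate 0, OF f] rate by (simp add: poisson_weight_def mult.commute)
  with total_variation_eq_sums[of ?p q]
  have "(\<lambda>k. pmf q k * f k) sums (poisson_mean f 0 rate - total_variation ?p q)"
    using sums_diff[of "\<lambda>k. pmf ?p k * f k" _ "\<lambda>k. (pmf ?p k - pmf q k) * f k"]
    by (fastforce simp: f_def algebra_simps)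
  from sums_diff[OF sums_mult[OF pmf_sums_1[of q], of "poisson_mean f 0 rate"] this]
  have "(\<lambda>k. pmf q k * (poisson_mean f 0 rate - f k)) sums total_variation ?p q"
    by (simp add: algebra_simps)
  also have "(\<lambda>k. pmf q k * (poisson_mean f 0 rate - f k)) =
      (\<lambda>k. real k * g k * pmf q k - rate * (g (Suc k) * pmf q k))"
  proof
    fix k
    have "poisson_mean f 0 rate - f k = real k * g k - rate * g (Suc k)"
      using stein[of k] by linarith
    then show "pmf q k * (poisson_mean f 0 rate - f k) =
        real k * g k * pmf q k - rate * (g (Suc k) * pmf q k)"
      by (simp only: right_diff_distrib) (simp add: mult_ac)
  qed
  finally have tv: "(\<lambda>k. real k * g k * pmf q k - rate * (g (Suc k) * pmf q k)) sums
      total_variation ?p q" .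
  have gq: "summable (\<lambda>k. rate * (g (Suc k) * pmf q k))"
  proof (rule summable_mult, rule summable_comparison_test'[where N = 0])
    show "summable (\<lambda>k. ?H * pmf q k)" using pmf_sums_1 by (intro summable_mult sums_summable)
    show "norm (g (Suc k) * pmf q k) \<le> ?H * pmf q k" for k
      using g by (simp add: abs_mult mult_right_mono)
  qed
  have mean: "(\<lambda>k. real (Suc k) * g (Suc k) * pmf q (Suc k) - rate * (g (Suc k) * pmf q k)) sums
      total_variation ?p q"
  proof -
    from summable_add[OF sums_summable[OF tv] gq]
    \<comment> \<open>The averaged Stein equation converges, and so does one of its two sums; hence the
        other one does as well, although its weights \<open>k * g k\<close> are unbounded a priori.\<close>
    have *: "summable (\<lambda>k. real k * g k * pmf q k)" by simp
    define A where "A = (\<Sum>k. real k * g k * pmf q k)"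
    define B where "B = (\<Sum>k. rate * (g (Suc k) * pmf q k))"
    have A: "(\<lambda>k. real k * g k * pmf q k) sums A"
      unfolding A_def using * by (rule summable_sums)
    have B: "(\<lambda>k. rate * (g (Suc k) * pmf q k)) sums B"
      unfolding B_def using gq by (rule summable_sums)
    have "total_variation ?p q = A - B" by (rule sums_unique2[OF tv sums_diff[OF A B]])
    moreover have "(\<lambda>k. real (Suc k) * g (Suc k) * pmf q (Suc k)) sums A"
      using A by (subst sums_Suc_iff) simp
    ultimately show ?thesis using sums_diff[OF _ B] by simp
  qed
  show ?thesis
  proof (rule sums_le[OF _ mean sums_mult[OF S, of ?H]])
    fix k
    have "real (Suc k) * g (Suc k) * pmf q (Suc k) - rate * (g (Suc k) * pmf q k)
        = g (Suc k) * (real (Suc k) * pmf q (Suc k) - rate * pmf q k)"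
      by (simp add: algebra_simps)
    also have "\<dots> \<le> \<bar>g (Suc k)\<bar> * \<bar>real (Suc k) * pmf q (Suc k) - rate * pmf q k\<bar>"
      by (metis abs_ge_self abs_mult)
    also have "\<dots> \<le> ?H * \<bar>real (Suc k) * pmf q (Suc k) - rate * pmf q k\<bar>"
      by (intro mult_right_mono g) auto
    finally show "real (Suc k) * g (Suc k) * pmf q (Suc k) - rate * (g (Suc k) * pmf q k)
        \<le> ?H * \<bar>real (Suc k) * pmf q (Suc k) - rate * pmf q k\<bar>" .
  qed
qed

section \<open>The Fisher information bounds\<close>

text \<open>
  Either the second moment of \<open>Z\<close> is infinite, and a bound by its root is trivial, or \<open>Z\<close> is
  absolutely summable against \<open>q\<close> and the first absolute moment is at most the root of the second,
  because a variance is nonnegative.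
\<close>
lemma pmf_mean_square_cases:
  fixes Z :: "nat \<Rightarrow> real"
  obtains "pmf_mean q (\<lambda>k. (Z k)\<^sup>2) = \<infinity>"
  | V S where "V \<ge> 0" "pmf_mean q (\<lambda>k. (Z k)\<^sup>2) = ereal V"
      "(\<lambda>k. pmf q k * \<bar>Z k\<bar>) sums S" "S \<le> sqrt V"
proof (cases "(\<integral>\<^sup>+ k. ennreal ((Z k)\<^sup>2) \<partial>measure_pmf q) = \<infinity>")
  case True
  then show ?thesis using that(1) by (simp add: pmf_mean_def)
next
  case False
  then have sq: "integrable (measure_pmf q) (\<lambda>k. (Z k)\<^sup>2)"
    by (intro integrableI_nonneg) (auto simp: top.not_eq_extremum)
  then have sq': "integrable (measure_pmf q) (\<lambda>k. \<bar>Z k\<bar>\<^sup>2)" by simp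
  define V where "V = measure_pmf.expectation q (\<lambda>k. (Z k)\<^sup>2)"
  define S where "S = measure_pmf.expectation q (\<lambda>k. \<bar>Z k\<bar>)"
  have V: "V \<ge> 0" by (simp add: V_def)
  have eq: "pmf_mean q (\<lambda>k. (Z k)\<^sup>2) = ereal V"
    using nn_integral_eq_integral[OF sq] V by (simp add: pmf_mean_def V_def)
  have int: "integrable (measure_pmf q) (\<lambda>k. \<bar>Z k\<bar>)"
    by (rule measure_pmf.square_integrable_imp_integrable[OF _ sq']) simp
  have "S\<^sup>2 \<le> V"
    using measure_pmf.variance_eq[OF int sq'] measure_pmf.variance_positive[of q "\<lambda>k. \<bar>Z k\<bar>"]
    by (simp add: S_def V_def)
  then have "S \<le> sqrt V" by (rule real_le_rsqrt)
  moreover have "(\<lambda>k. pmf q k * \<bar>Z k\<bar>) sums S"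
  proof -
    have "integrable (count_space UNIV) (\<lambda>k. pmf q k * \<bar>Z k\<bar>)"
      using int unfolding measure_pmf_eq_density by (subst (asm) integrable_density) auto
    then have "(\<lambda>k. pmf q k * \<bar>Z k\<bar>) sums (\<integral>k. pmf q k * \<bar>Z k\<bar> \<partial>count_space UNIV)"
      by (rule sums_integral_count_space_nat)
    also have "(\<integral>k. pmf q k * \<bar>Z k\<bar> \<partial>count_space UNIV) = S"
      unfolding S_def measure_pmf_eq_density by (subst integral_density) auto
    finally show ?thesis .
  qed
  ultimately show ?thesis using that(2) V eq by blast
qed

lemma stein_factor_pos: "rate > 0 \<Longrightarrow> stein_factor rate > 0"
  by (simp add: stein_factor_def)

text \<open>
  The terms of the sum in \<open>total_variation_poisson_le\<close> are divided by \<open>q k\<close>. A \<open>k\<close> with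
  \<open>q k = 0\<close> but \<open>q (k + 1) > 0\<close> would contribute to that sum, but not to the Fisher information;
  this is why the support has to be an initial segment.
\<close>
lemma total_variation_le_scaled_fisher:
  assumes rate: "rate > 0" and supp: "\<And>k. pmf q k = 0 \<Longrightarrow> pmf q (Suc k) = 0"
  shows "ereal (total_variation (poisson_pmf rate) q)
    \<le> ereal (sqrt rate * stein_factor rate) * ereal_sqrt (scaled_fisher_information rate q)"
proof -
  define Z where "Z k = real (k + 1) * pmf q (k + 1) / (rate * pmf q k) - 1" for k
  have K: "scaled_fisher_information rate q = ereal rate * pmf_mean q (\<lambda>k. (Z k)\<^sup>2)"
    by (simp add: scaled_fisher_information_def Z_def)
  show ?thesis
  proof (cases rule: pmf_mean_square_cases[of q Z])
    case 1
    then show ?thesis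
      using rate stein_factor_pos[OF rate] by (simp add: K ereal_sqrt_def)
  next
    case (2 V S)
    have eq: "rate * (pmf q k * \<bar>Z k\<bar>) = \<bar>real (Suc k) * pmf q (Suc k) - rate * pmf q k\<bar>" for k
    proof (cases "pmf q k = 0")
      case False
      have "rate * (pmf q k * \<bar>Z k\<bar>) = \<bar>rate * pmf q k * Z k\<bar>" using rate by (simp add: abs_mult)
      also have "rate * pmf q k * Z k = real (Suc k) * pmf q (Suc k) - rate * pmf q k"
        using False rate by (simp add: Z_def field_simps)
      finally show ?thesis .
    qed (simp add: supp)
    from sums_mult[OF 2(3), of rate]
    have "total_variation (poisson_pmf rate) q \<le> stein_factor rate * (rate * S)"
      unfolding eq by (rule total_variation_poisson_le[OF rate])
    also have "\<dots> \<le> stein_factor rate * (rate * sqrt V)"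
      using rate 2(4) stein_factor_pos[OF rate] by (intro mult_left_mono) auto
    also have "\<dots> = sqrt rate * stein_factor rate * sqrt (rate * V)"
      using rate by (simp add: real_sqrt_mult)
    finally show ?thesis by (simp add: K 2 ereal_sqrt_def)
  qed
qed

text \<open>
  Here the terms are divided by \<open>q (k + 1)\<close>, so that \<open>q\<close> must not vanish at any successor. The
  index 0 contributes nothing to the Fisher information, because of \<open>q (- 1) = 0\<close>.
\<close>
lemma total_variation_le_discrete_fisher:
  assumes rate: "rate > 0" and supp: "\<And>k. pmf q k > 0"
  shows "ereal (total_variation (poisson_pmf rate) q)
    \<le> ereal (stein_factor rate) * ereal_sqrt (discrete_fisher_information rate q)"
proof -
  define Z where "Z k = rate * (if k = 0 then 0 else pmf q (k - 1)) / pmf q k - real k" for k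
  have K: "discrete_fisher_information rate q = pmf_mean q (\<lambda>k. (Z k)\<^sup>2)"
    by (simp add: discrete_fisher_information_def Z_def)
  show ?thesis
  proof (cases rule: pmf_mean_square_cases[of q Z])
    case 1
    then show ?thesis
      using stein_factor_pos[OF rate] by (simp add: K ereal_sqrt_def)
  next
    case (2 V S)
    have "(\<lambda>k. pmf q (Suc k) * \<bar>Z (Suc k)\<bar>) sums S"
      using 2(3) by (subst sums_Suc_iff) (simp add: Z_def)
    moreover have "pmf q (Suc k) * \<bar>Z (Suc k)\<bar> = \<bar>real (Suc k) * pmf q (Suc k) - rate * pmf q k\<bar>" for k
    proof -
      have "pmf q (Suc k) * \<bar>Z (Suc k)\<bar> = \<bar>pmf q (Suc k) * Z (Suc k)\<bar>" by (simp add: abs_mult)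
      also have "pmf q (Suc k) * Z (Suc k) = rate * pmf q k - real (Suc k) * pmf q (Suc k)"
        using supp[of "Suc k"] by (simp add: Z_def field_simps)
      finally show ?thesis by (simp add: abs_minus_commute)
    qed
    ultimately have "total_variation (poisson_pmf rate) q \<le> stein_factor rate * S"
      by (intro total_variation_poisson_le[OF rate]) simp
    also have "\<dots> \<le> stein_factor rate * sqrt V"
      using 2(4) stein_factor_pos[OF rate] by (intro mult_left_mono) auto
    finally show ?thesis by (simp add: K 2 ereal_sqrt_def)
  qed
qed

theorem proposition4p1:
  fixes rate :: real
  assumes "rate > 0"
  shows "\<exists>(C :: real) (e :: enat \<Rightarrow> nat pmf \<Rightarrow> real).
    \<forall>(N :: enat) (q :: nat pmf). set_pmf q = {k. enat k \<le> N} \<longrightarrow>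
      ereal (total_variation (poisson_pmf rate) q)
        \<le> ereal (sqrt rate * stein_factor rate) * ereal_sqrt (scaled_fisher_information rate q)
          + ereal (e N q) \<and>
      (\<forall>n. N = enat n \<longrightarrow> \<bar>e N q\<bar> \<le> C * (pmf q n / real (n + 1))) \<and>
      (N = \<infinity> \<longrightarrow> e N q = 0) \<and>
      (N = \<infinity> \<longrightarrow>
        ereal (total_variation (poisson_pmf rate) q)
          \<le> ereal (stein_factor rate) * ereal_sqrt (discrete_fisher_information rate q))"
proof -
  have "ereal (total_variation (poisson_pmf rate) q)
        \<le> ereal (sqrt rate * stein_factor rate) * ereal_sqrt (scaled_fisher_information rate q)"
    if "set_pmf q = {k. enat k \<le> N}" for N q
  proof (rule total_variation_le_scaled_fisher[OF assms])
    fix k assume "pmf q k = 0"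
    then have "\<not> enat k \<le> N" using that by (auto simp: set_pmf_eq)
    then have "\<not> enat (Suc k) \<le> N" by (meson enat_ord_simps(1) le_SucI order_refl order_trans)
    then show "pmf q (Suc k) = 0" using that by (auto simp: set_pmf_eq)
  qed
  moreover have "ereal (total_variation (poisson_pmf rate) q)
        \<le> ereal (stein_factor rate) * ereal_sqrt (discrete_fisher_information rate q)"
    if "set_pmf q = {k. enat k \<le> \<infinity>}" for q
    using that by (intro total_variation_le_discrete_fisher assms) (simp add: pmf_positive_iff)
  ultimately show ?thesis
    by (intro exI[of _ 0] exI[of _ "\<lambda>_ _. 0"]) (auto simp: zero_ereal_def[symmetric])
qed

end
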